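(* For every prime number $n$, the number of partitions $\pi$ of $n$ such that the multinomial coefficient $b(\pi)$ is divisible by the number of parts $k$ of $\pi$ is equal to $p(n)-1$, where $p(n)$ is the number of all partitions of $n$.
   Context: A partition $\pi=\{\lambda_1,\ldots,\lambda_k\}$ of a natural number $n$ into $k$ parts is a multiset of $k$ positive integers with $\lambda_1+\cdots+\lambda_k=n$ (order is irrelevant). If $\pi$ has $k$ parts, and its distinct part values occur with multiplicities $j_1,\ldots,j_m$ (so $j_1+\cdots+j_m=k$), then the multinomial coefficient based on $\pi$ is $b(\pi)=\binom{k}{j_1,\ldots,j_m}=\frac{k!}{j_1!\,j_2!\cdots j_m!}$. The count ranges over all partitions of $n$ with any number of parts $k=1,\ldots,n$; each partition is counted separately, even if two partitions give the same value of $b$. The $n$-th term of the integer sequence A200144 is this count. *)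

theory Defs
  imports "HOL-Combinatorics.Multiset_Permutations" "HOL-Computational_Algebra.Primes"
begin

definition partitions :: "nat \<Rightarrow> nat multiset set" where
  "partitions n = {\<pi>. (\<forall>x\<in>#\<pi>. 0 < x) \<and> sum_mset \<pi> = n}"

definition partition_number :: "nat \<Rightarrow> nat" where
  "partition_number n = card (partitions n)"

text \<open>The natural-number division below is exact, see \<open>multinomial_exact\<close>.\<close>

definition partition_multinomial :: "nat multiset \<Rightarrow> nat" where
  "partition_multinomial \<pi> = fact (size \<pi>) div (\<Prod>x\<in>set_mset \<pi>. fact (count \<pi> x))"

lemma multinomial_exact:
  "partition_multinomial \<pi> * (\<Prod>x\<in>set_mset \<pi>. fact (count \<pi> x)) = fact (size \<pi>)"
  using card_permutations_of_multiset[of \<pi>] by (simp add: partition_multinomial_def)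

text \<open>By the next two lemmas the cardinality in \<open>partition_number\<close> is a genuine count, and the truncated
  subtraction in \<open>partition_number n - 1\<close> is harmless for positive \<open>n\<close>.\<close>

lemma finite_partitions: "finite (partitions n)"
proof (rule finite_subset)
  show "partitions n \<subseteq> mset ` {xs. set xs \<subseteq> {..n} \<and> length xs \<le> n}"
  proof
    fix \<pi> assume "\<pi> \<in> partitions n"
    then have pos: "\<forall>x\<in>#\<pi>. 0 < x" and sum: "sum_mset \<pi> = n"
      by (auto simp: partitions_def)
    obtain xs where xs: "mset xs = \<pi>" by (metis ex_mset)
    have "set xs \<subseteq> {..sum_list xs}" by (auto intro: member_le_sum_list)
    moreover have "(\<forall>x\<in>set xs. 0 < x) \<Longrightarrow> length xs \<le> sum_list xs"
      by (induction xs) auto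
    ultimately show "\<pi> \<in> mset ` {xs. set xs \<subseteq> {..n} \<and> length xs \<le> n}"
      using pos sum xs by (auto simp flip: sum_mset_sum_list)
  qed
  show "finite (mset ` {xs. set xs \<subseteq> {..n} \<and> length xs \<le> n})"
    by (intro finite_imageI finite_lists_length_le) auto
qed

lemma partition_number_pos: "0 < n \<Longrightarrow> 0 < partition_number n"
proof -
  assume "0 < n"
  then have "{#n#} \<in> partitions n" by (simp add: partitions_def)
  then show ?thesis using finite_partitions by (auto simp: partition_number_def card_gt_0_iff)
qed

end

theory Submission
  imports Defs
begin

text \<open>Let \<open>d\<close> be the greatest common divisor of the multiplicities of a partition of \<open>n\<close>. Counting
  the arrangements of the parts by their first entry shows that the number \<open>k\<close> of parts divides the
  multinomial coefficient times each multiplicity, hence times \<open>d\<close>. Grouping equal parts shows that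
  \<open>d\<close> divides \<open>n\<close>. For prime \<open>n\<close> this leaves \<open>d = 1\<close>, where \<open>k\<close> divides the coefficient itself, and
  \<open>d = n\<close>. As soon as some part \<open>x\<close> exceeds 1, its multiplicity is less than \<open>n\<close>, so \<open>d = 1\<close>. The
  partition into \<open>n\<close> ones therefore is the only possible exception, and it is one: its coefficient
  is 1, which \<open>n > 1\<close> does not divide.\<close>

text \<open>In \<open>k! / (j_1! \<dots> j_m!)\<close>, numerator and denominator only lose the factors \<open>size A\<close> and \<open>count A x\<close> when one copy of \<open>x\<close> is removed,
  so the cofactor of \<open>size A\<close> is the multinomial coefficient of \<open>A - {#x#}\<close>.\<close>

lemma size_dvd_multinomial_times_count:
  assumes "x \<in># A"
  shows "size A dvd partition_multinomial A * count A x"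
  using card_permutations_of_multiset_remove_aux[OF assms]
  by (simp add: partition_multinomial_def card_permutations_of_multiset)

lemma size_dvd_multinomial_times_Gcd:
  "size A dvd partition_multinomial A * Gcd (count A ` set_mset A)"
proof -
  have "size A dvd Gcd ((*) (partition_multinomial A) ` count A ` set_mset A)"
    by (intro Gcd_greatest) (auto intro: size_dvd_multinomial_times_count)
  then show ?thesis
    by (simp add: Gcd_mult)
qed

lemma sum_mset_eq_sum_count:
  fixes A :: "nat multiset"
  shows "sum_mset A = (\<Sum>x\<in>set_mset A. count A x * x)"
proof -
  \<comment> \<open>A fixed index set \<open>S\<close> spares the induction the case distinction whether the added element is new.\<close>
  have "sum_mset A = (\<Sum>x\<in>S. count A x * x)" if "finite S" "set_mset A \<subseteq> S" for S
    using that
  proof (induction A)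
    case (add y A)
    have "(\<Sum>x\<in>S. count (add_mset y A) x * x)
        = (\<Sum>x\<in>S. count A x * x + (if x = y then x else 0))"
      by (intro sum.cong) auto
    with add show ?case
      by (simp add: sum.distrib)
  qed simp
  then show ?thesis by simp
qed

lemma Gcd_count_dvd_sum_mset:
  fixes A :: "nat multiset"
  shows "Gcd (count A ` set_mset A) dvd sum_mset A"
  unfolding sum_mset_eq_sum_count by (intro dvd_sum dvd_mult2 Gcd_dvd imageI)

lemma count_times_le_sum_mset:
  fixes A :: "nat multiset"
  assumes "x \<in># A"
  shows "count A x * x \<le> sum_mset A"
  unfolding sum_mset_eq_sum_count using assms by (intro member_le_sum) auto

lemma partition_into_ones:
  assumes "A \<in> partitions n" and "\<And>x. x \<in># A \<Longrightarrow> x \<le> 1"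
  shows "A = replicate_mset n 1"
proof -
  have "x = 1" if "x \<in># A" for x
    using assms that by (force simp: partitions_def)
  then have "A = replicate_mset (size A) 1"
    by (metis set_mset_subset_singletonD singleton_iff subsetI)
  moreover from this have "sum_mset A = size A"
    by (metis mult.right_neutral sum_mset_replicate_mset of_nat_id)
  ultimately show ?thesis
    using assms(1) by (simp add: partitions_def)
qed

lemma size_dvd_multinomial_if_not_ones:
  assumes "prime n" and A: "A \<in> partitions n" and "A \<noteq> replicate_mset n 1"
  shows "size A dvd partition_multinomial A"
proof -
  let ?d = "Gcd (count A ` set_mset A)"
  from partition_into_ones[OF A] assms(3) obtain x where x: "x \<in># A" "1 < x"
    by (meson not_le)
  have "?d \<le> count A x"
    using x by (intro dvd_imp_le Gcd_dvd) auto
  also have "count A x < count A x * x"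
    using x by simp
  also have "\<dots> \<le> n"
    using count_times_le_sum_mset[OF x(1)] A by (simp add: partitions_def)
  finally have "?d \<noteq> n" by simp
  moreover have "?d dvd n"
    using Gcd_count_dvd_sum_mset[of A] A by (simp add: partitions_def)
  ultimately have "?d = 1"
    using \<open>prime n\<close> by (metis prime_nat_iff)
  then show ?thesis
    using size_dvd_multinomial_times_Gcd[of A] by simp
qed

lemma partition_multinomial_replicate:
  "partition_multinomial (replicate_mset n x) = 1"
  by (simp add: partition_multinomial_def)

theorem mainTheorem1:
  fixes n :: nat
  assumes "prime n"
  shows "card {\<pi> \<in> partitions n. size \<pi> dvd partition_multinomial \<pi>} = partition_number n - 1"
proof -
  let ?ones = "replicate_mset n (1::nat)"
  have "1 < n"
    using assms by (rule prime_gt_1_nat)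
  then have "\<not> size ?ones dvd partition_multinomial ?ones"
    unfolding partition_multinomial_replicate by simp
  with size_dvd_multinomial_if_not_ones[OF assms]
  have "{\<pi> \<in> partitions n. size \<pi> dvd partition_multinomial \<pi>} = partitions n - {?ones}"
    by blast
  moreover have "?ones \<in> partitions n"
    by (simp add: partitions_def)
  ultimately show ?thesis
    by (simp add: partition_number_def)
qed

end
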